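(* Let $F$ be a continuous distribution function on $\mathbb{R}$, with $a=\inf\{x:F(x)>0\}$ and $b=\sup\{x:F(x)<1\}$. Let $1<p<\infty$, $h\in L_p(F)$ and $k\in\overline{\mathbb{R}}=[-\infty,+\infty]$. Then $$ \|T_k(h)\|_p^p=\int_{a<x\le k}\left|\frac{\int_{-\infty}^x h\,dF}{F(x)}\right|^p dF(x)+\int_{b>x\ge k}\left|\frac{\int_x^\infty h\,dF}{1-F(x)}\right|^p dF(x)\le\left(\frac{p}{p-1}\right)^p\|h\|_p^p . $$ In particular, $$\int_{\mathbb{R}}\left|\frac{1}{F(x)}\int_{(-\infty,x]}h(y)\,dF(y)\right|^p dF(x)\le\left(\frac{p}{p-1}\right)^p\int_{\mathbb{R}}|h(x)|^p\,dF(x)$$ and $$\int_{\mathbb{R}}\left|\frac{1}{1-F(x)}\int_{(x,\infty)}h(y)\,dF(y)\right|^p dF(x)\le\left(\frac{p}{p-1}\right)^p\int_{\mathbb{R}}|h(x)|^p\,dF(x).$$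
   Context: $L_p(F)$ is the $L_p$ space of the probability measure on $\mathbb{R}$ with distribution function $F$, with norm $\|\cdot\|_p$. For $k\in[-\infty,+\infty]$ and $x\in(a,b)$, $$T_kh(x)=\mathbf{1}_{(a,k]}(x)\frac{1}{F(x)}\int_{(a,x]}h\,dF+\mathbf{1}_{(k,b)}(x)\frac{1}{1-F(x)}\int_{(x,b)}h\,dF$$ (the complement of $(a,b)$ has measure zero). *)

theory Defs
  imports "HOL-Probability.Probability"
begin

definition distribution_function :: "(real \<Rightarrow> real) \<Rightarrow> bool" where
  "distribution_function F \<longleftrightarrow>
     mono F \<and> (\<forall>x. continuous (at_right x) F) \<and>
     (F \<longlongrightarrow> 0) at_bot \<and> (F \<longlongrightarrow> 1) at_top"

lemma distribution_function_real_distribution: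
  assumes "distribution_function F"
  shows "real_distribution (interval_measure F)" and "cdf (interval_measure F) = F"
  using assms unfolding distribution_function_def
  by (auto intro!: real_distribution_interval_measure cdf_interval_measure simp: mono_def)

definition lower_end :: "(real \<Rightarrow> real) \<Rightarrow> ereal" where
  "lower_end F = (INF x\<in>{x. F x > 0}. ereal x)"

definition upper_end :: "(real \<Rightarrow> real) \<Rightarrow> ereal" where
  "upper_end F = (SUP x\<in>{x. F x < 1}. ereal x)"

(* Elements are functions, not classes modulo null sets. *)
definition Lp_space :: "(real \<Rightarrow> real) \<Rightarrow> real \<Rightarrow> (real \<Rightarrow> real) set" where
  "Lp_space F p =
     {f \<in> borel_measurable borel. integrable (interval_measure F) (\<lambda>x. \<bar>f x\<bar> powr p)}"

(* The Bochner integral of a non-integrable function is 0, so this is the norm only on Lp_space. *)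
definition Lp_norm :: "(real \<Rightarrow> real) \<Rightarrow> real \<Rightarrow> (real \<Rightarrow> real) \<Rightarrow> real" where
  "Lp_norm F p f = (LINT x|interval_measure F. \<bar>f x\<bar> powr p) powr (1 / p)"

(* T_k h is specified on (a,b) only; its value on the complement, a null set, is set to 0. *)
definition T_op :: "(real \<Rightarrow> real) \<Rightarrow> ereal \<Rightarrow> (real \<Rightarrow> real) \<Rightarrow> real \<Rightarrow> real" where
  "T_op F k h x =
     (let a = lower_end F; b = upper_end F in
      if a < ereal x \<and> ereal x < b then
        indicator {x. a < ereal x \<and> ereal x \<le> k} x *
          (1 / F x * (LINT y:{y. a < ereal y \<and> y \<le> x}|interval_measure F. h y)) +
        indicator {x. k < ereal x \<and> ereal x < b} x *
          (1 / (1 - F x) * (LINT y:{y. x < y \<and> ereal y < b}|interval_measure F. h y))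
      else 0)"

end

theory Submission
  imports Defs
begin

text \<open>
  Since \<open>F\<close> is continuous, both \<open>F\<close> and \<open>1 - F\<close> are uniformly distributed on \<open>[0,1]\<close> under the
  measure \<open>\<mu>\<close> of \<open>F\<close>, so both one-sided inequalities are instances of a Hardy inequality for a
  uniformly distributed \<open>U\<close> and the averages of \<open>f\<close> over subsets of \<open>{U \<le> U x}\<close>. That one is
  obtained by inserting the weight \<open>U\<close> to the power \<open>(1 - 1/p) / p\<close> into Hoelder's inequality and
  applying Tonelli's theorem; this choice of weight gives the sharp constant. The inequality for
  \<open>T_k\<close> follows without loss in the constant, because the left averages at \<open>x \<le> k\<close> only see \<open>h\<close> on
  \<open>(-\<infinity>,k]\<close> and the right averages at \<open>x \<ge> k\<close> only see \<open>h\<close> on \<open>(k,\<infinity>)\<close>.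
\<close>

section \<open>Truncated power moments of a uniform variable\<close>

text \<open>With \<open>e = -1/p\<close> this is the dual factor in Hoelder's inequality. Dropping
  the cutoff of the density at 1 loses equality for \<open>u > 1\<close> but spares a case
  distinction.\<close>

lemma (in prob_space) nn_integral_uniform_atMost_powr:
  assumes U: "distributed M lborel U (indicator {0..1})" and e: "e > -1" and u: "u \<ge> 0"
  shows "(\<integral>\<^sup>+y. ennreal (U y powr e) * indicator {..u} (U y) \<partial>M) \<le> ennreal (u powr (e+1) / (e+1))"
proof -
  have "(\<integral>\<^sup>+y. ennreal (U y powr e) * indicator {..u} (U y) \<partial>M)
      = (\<integral>\<^sup>+t. indicator {0..1} t * (ennreal (t powr e) * indicator {..u} t) \<partial>lborel)"
    by (subst distributed_nn_integral[OF U]) auto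
  also have "\<dots> \<le> (\<integral>\<^sup>+t. ennreal (t powr e) * indicator {0..u} t \<partial>lborel)"
    by (intro nn_integral_mono) (auto simp: indicator_def)
  also have "\<dots> = ennreal (u powr (e+1) / (e+1))"
    using has_integral_powr_from_0[OF e u] by (intro nn_integral_has_integral_lebesgue') auto
  finally show ?thesis .
qed

text \<open>With \<open>e = 1/p - 2\<close> this is the inner integral after Tonelli. The tail
  beyond 1 may be added because \<open>e < -1\<close> makes it converge, and the resulting bound is
  still good enough for the sharp constant.\<close>

lemma (in prob_space) nn_integral_uniform_atLeast_powr:
  assumes U: "distributed M lborel U (indicator {0..1})" and e: "e < -1" and u: "u > 0"
  shows "(\<integral>\<^sup>+x. ennreal (U x powr e) * indicator {u..} (U x) \<partial>M) \<le> ennreal (- (u powr (e+1)) / (e+1))"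
proof -
  have "(\<integral>\<^sup>+x. ennreal (U x powr e) * indicator {u..} (U x) \<partial>M)
      = (\<integral>\<^sup>+t. indicator {0..1} t * (ennreal (t powr e) * indicator {u..} t) \<partial>lborel)"
    by (subst distributed_nn_integral[OF U]) auto
  also have "\<dots> \<le> (\<integral>\<^sup>+t. ennreal (t powr e) * indicator {u..} t \<partial>lborel)"
    by (intro nn_integral_mono) (auto simp: indicator_def)
  also have "\<dots> = ennreal (- (u powr (e+1)) / (e+1))"
    using has_integral_powr_to_inf[OF e u] by (intro nn_integral_has_integral_lebesgue') auto
  finally show ?thesis .
qed

text \<open>The strict bound at 0 is what permits dividing by \<open>U\<close> and cancelling its
  powers.\<close>

lemma (in prob_space) AE_uniform:
  assumes U: "distributed M lborel U (indicator {0..1::real})"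
  shows "AE x in M. 0 < U x \<and> U x \<le> 1"
proof -
  have [measurable]: "U \<in> borel_measurable M" using distributed_measurable[OF U] by simp
  have "(\<integral>\<^sup>+x. indicator (- {0<..1}) (U x) \<partial>M) = (\<integral>\<^sup>+t. indicator {0..1} t * indicator (- {0<..1}) (t::real) \<partial>lborel)"
    by (rule distributed_nn_integral[OF U, symmetric]) auto
  also have "\<dots> = (\<integral>\<^sup>+t. indicator {0} (t::real) \<partial>lborel)"
    by (intro nn_integral_cong) (auto simp: indicator_def)
  also have "\<dots> = 0" by simp
  finally have "AE x in M. indicator (- {0<..1}) (U x) = (0::ennreal)"
    by (subst (asm) nn_integral_0_iff_AE) auto
  then show ?thesis by eventually_elim (auto simp: indicator_def split: if_splits)
qed

section \<open>Hoelder's inequality with a power weight\<close>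

text \<open>Young's inequality for the factors \<open>z * w powr s\<close> and
  \<open>c powr (p-1) * w powr (-s)\<close>, scaled by \<open>p\<close>. Integrating it first and
  fixing \<open>c\<close> afterwards yields Hoelder's inequality without normalising by an integral
  not yet known to be finite.\<close>

lemma weighted_Young:
  fixes p c w z :: real
  assumes p: "p > 1" and c: "c > 0" and w: "w > 0" and z: "z \<ge> 0"
  shows "p * c powr (p - 1) * z \<le> z powr p * w powr (1 - 1/p) + (p - 1) * c powr p * w powr (- (1/p))"
proof -
  define q where "q = p / (p - 1)"
  \<comment> \<open>Makes \<open>s * p = 1 - 1/p\<close> and \<open>s * q = 1/p\<close>, the
    exponents of \<open>w\<close> in the claim up to sign.\<close>
  define s where "s = 1 / (p * q)"
  have q: "q > 1" "1/p + 1/q = 1" using p by (auto simp: q_def field_simps)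
  have sp: "s * p = 1 - 1/p" "s * q = 1/p" "(p - 1) * q = p" "p / q = p - 1" 
    using p q by (auto simp: s_def q_def field_simps)
  have "(z * w powr s) * (c powr (p-1) * w powr (-s)) \<le> (z * w powr s) powr p / p + (c powr (p-1) * w powr (-s)) powr q / q"
    using p q z by (intro Youngs_inequality) auto
  also have "(z * w powr s) * (c powr (p-1) * w powr (-s)) = c powr (p-1) * z"
    using w by (simp add: powr_minus field_simps)
  also have "(z * w powr s) powr p = z powr p * w powr (1 - 1/p)"
    using z by (simp add: powr_mult powr_powr sp)
  also have "(c powr (p-1) * w powr (-s)) powr q = c powr p * w powr (-(1/p))"
    using c by (simp add: powr_mult powr_powr sp)
  finally have "p * (c powr (p-1) * z) \<le> p * (z powr p * w powr (1 - 1/p) / p + c powr p * w powr (-(1/p)) / q)"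
    using p by (intro mult_left_mono) auto
  also have "\<dots> = z powr p * w powr (1 - 1/p) + p / q * c powr p * w powr (-(1/p))"
    using p by (simp add: field_simps)
  finally show ?thesis by (simp add: sp mult_ac)
qed

text \<open>With \<open>q = p / (p - 1)\<close>, Hoelder bounds the \<open>p\<close>-th power of the
  integral by \<open>?K\<close> times the \<open>(p - 1)\<close>-th power of a moment that is at
  most \<open>q * u powr (1/q)\<close>; dividing by \<open>u powr p\<close> leaves
  \<open>u powr (1/p - 2)\<close>. \<open>S\<close> need not be all of \<open>U y \<le> u\<close>:
  when \<open>U\<close> is a distribution function with flat stretches, a half-line can be strictly
  smaller than that set.\<close>

lemma (in prob_space) integral_average_powr_le:
  fixes p u :: real
  assumes U: "distributed M lborel U (indicator {0..1})" and p: "p > 1" and u: "u > 0"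
    and f: "integrable M f" and S: "S \<in> sets M" "\<And>y. y \<in> S \<Longrightarrow> U y \<le> u"
  shows "ennreal (\<bar>(LINT y:S|M. f y) / u\<bar> powr p) \<le>
    ennreal ((p / (p - 1)) powr (p - 1) * u powr (1/p - 2)) *
    (\<integral>\<^sup>+y. ennreal (\<bar>f y\<bar> powr p * U y powr (1 - 1/p)) * indicator {..u} (U y) \<partial>M)"
    (is "_ \<le> ennreal ?C * ?K")
proof -
  have [measurable]: "U \<in> borel_measurable M" using distributed_measurable[OF U] by simp
  note [measurable] = borel_measurable_integrable[OF f] S(1)
  define q where "q = p / (p - 1)"
  have q: "q > 1" "1 - 1/p = 1/q" "(p - 1) * q = p" using p by (auto simp: q_def field_simps)
  define G where "G = (LINT y:S|M. \<bar>f y\<bar>)"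
  have int: "integrable M (\<lambda>y. indicator S y * \<bar>f y\<bar>)"
    using f by (intro integrable_real_mult_indicator[unfolded mult.commute[of _ "indicator _ _"]]) auto
  have le_G: "\<bar>LINT y:S|M. f y\<bar> \<le> G"
    unfolding G_def set_lebesgue_integral_def
    by (rule order_trans[OF integral_abs_bound]) (auto simp: abs_mult)
  have G0: "G \<ge> 0" unfolding G_def set_lebesgue_integral_def by (intro integral_nonneg_AE) auto
  have "ennreal ((G / u) powr p) \<le> ennreal ?C * ?K"
  proof (cases "G = 0")
    case False
    \<comment> \<open>the value of \<open>c\<close> for which the integrated Young inequality becomes Hoelder's\<close>
    define c where "c = G / (q * u powr (1/q))"
    have c: "c > 0" using False G0 q u by (auto simp: c_def)
    have "ennreal (p * c powr (p-1) * G) = (\<integral>\<^sup>+y. ennreal (p * c powr (p-1) * (indicator S y * \<bar>f y\<bar>)) \<partial>M)"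
      unfolding G_def set_lebesgue_integral_def using int p
      by (subst nn_integral_eq_integral) auto
    also have "\<dots> \<le> (\<integral>\<^sup>+y. ennreal (\<bar>f y\<bar> powr p * U y powr (1 - 1/p)) * indicator {..u} (U y)
          + ennreal ((p - 1) * c powr p) * (ennreal (U y powr (- (1/p))) * indicator {..u} (U y)) \<partial>M)"
    proof (rule nn_integral_mono_AE, use AE_uniform[OF U] in eventually_elim)
      case (elim y)
      show ?case
      proof (cases "y \<in> S")
        case True
        then have "U y \<le> u" by (rule S)
        with True elim p weighted_Young[OF p c, of "U y" "\<bar>f y\<bar>"] show ?thesis
          by (auto simp flip: ennreal_mult ennreal_plus intro!: ennreal_leI)
      qed simp
    qed
    also have "\<dots> = ?K + ennreal ((p - 1) * c powr p) * (\<integral>\<^sup>+y. ennreal (U y powr (- (1/p))) * indicator {..u} (U y) \<partial>M)"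
      by (subst nn_integral_add) (auto simp: nn_integral_cmult)
    also have "\<dots> \<le> ?K + ennreal ((p - 1) * c powr p) * ennreal (u powr (- (1/p) + 1) / (- (1/p) + 1))"
      using p u by (intro add_left_mono mult_left_mono nn_integral_uniform_atMost_powr[OF U]) auto
    also have "ennreal ((p - 1) * c powr p) * ennreal (u powr (- (1/p) + 1) / (- (1/p) + 1)) = ennreal (p * c powr p * u powr (1/q))"
      using p q by (simp add: q_def flip: ennreal_mult)
    finally have "ennreal (p * c powr (p-1) * G) \<le> ?K + ennreal (p * c powr p * u powr (1/q))" .
    \<comment> \<open>Since \<open>c * u powr (1/q) = G / q\<close>, the last Young term is the
      fraction \<open>1/q\<close> of the left side. Being finite it can be cancelled in
      \<open>ennreal\<close>, and the remaining fraction \<open>1/p\<close> is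
      \<open>c powr (p-1) * G\<close>.\<close>
    moreover have "p * c powr (p-1) * G = c powr (p-1) * G + p * c powr p * u powr (1/q)"
    proof -
      have "c powr p = c powr (p-1) * c" using c by (simp add: powr_diff)
      moreover have "c * u powr (1/q) = G / q" using u q by (simp add: c_def)
      ultimately have "p * c powr p * u powr (1/q) = p * c powr (p-1) * (G / q)" 
        by (metis (no_types, lifting) mult.assoc)
      moreover have "p * (G / q) = p * G - G"
        using p by (simp add: q_def field_simps)
      then have "p * c powr (p-1) * (G / q) = c powr (p-1) * (p * G - G)"
        by (metis mult.assoc mult.commute)
      ultimately show ?thesis by (simp add: right_diff_distrib)
    qed
    ultimately have "ennreal (c powr (p-1) * G) + ennreal (p * c powr p * u powr (1/q)) \<le> ?K + ennreal (p * c powr p * u powr (1/q))"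
      using G0 p by simp
    then have K: "ennreal (c powr (p-1) * G) \<le> ?K"
      by (simp add: ennreal_add_left_cancel_le add.commute[of _ "ennreal (p * c powr p * u powr (1/q))"])
    \<comment> \<open>The powers of \<open>q\<close> cancel, and
      \<open>(p - 1) / q = p - 2 + 1/p\<close> turns the powers of \<open>u\<close> into
      \<open>u powr (- p)\<close>.\<close>
    have "(G / u) powr p = ?C * (c powr (p-1) * G)"
    proof -
      have e: "(p - 1) / q = p - 2 + 1/p" using p by (simp add: q_def field_simps power2_eq_square)
      have "c powr (p-1) = G powr (p-1) / (q powr (p-1) * u powr (p - 2 + 1/p))"
        using G0 q u by (simp add: c_def powr_divide powr_mult powr_powr e)
      moreover have "G powr p = G powr (p-1) * G" using False G0 by (simp add: powr_diff)
      moreover have "u powr (1/p - 2) / u powr (p - 2 + 1/p) = u powr (- p)"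
        by (simp flip: powr_diff)
      moreover have "(G / u) powr p = G powr p * u powr (- p)"
        using G0 u by (simp add: powr_divide powr_minus_divide)
      ultimately have "(G / u) powr p = G powr (p-1) * G * (u powr (1/p - 2) / u powr (p - 2 + 1/p))"
        by simp
      then show ?thesis using q \<open>c powr (p-1) = _\<close> by (simp flip: q_def)
    qed
    then have "ennreal ((G / u) powr p) = ennreal ?C * ennreal (c powr (p-1) * G)"
      using G0 by (simp only: ennreal_mult mult_nonneg_nonneg powr_ge_zero)
    then show ?thesis using K by (simp only: mult_left_mono zero_le)
  qed auto
  moreover have "\<bar>(LINT y:S|M. f y) / u\<bar> powr p \<le> (G / u) powr p"
    using le_G u p by (intro powr_mono2) (auto simp: divide_right_mono)
  ultimately show ?thesis by (meson ennreal_leI order_trans)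
qed

section \<open>Hardy's inequality for a uniform variable\<close>

text \<open>Constants are integrable here, and \<open>1 + \<bar>z\<bar> powr p\<close> dominates
  \<open>\<bar>z\<bar>\<close>. Hence the averages below are genuine integrals and not the default
  value 0.\<close>

lemma (in prob_space) integrable_powr_imp_integrable:
  fixes f :: "'a \<Rightarrow> real"
  assumes p: "p \<ge> 1" and [measurable]: "f \<in> borel_measurable M" and f: "integrable M (\<lambda>x. \<bar>f x\<bar> powr p)"
  shows "integrable M f"
proof (rule Bochner_Integration.integrable_bound)
  show "integrable M (\<lambda>x. 1 + \<bar>f x\<bar> powr p)" using f by auto
  have "\<bar>z\<bar> \<le> 1 + \<bar>z\<bar> powr p" for z :: real
  proof (cases "\<bar>z\<bar> \<le> 1")
    case False
    then show ?thesis using powr_mono[of 1 p "\<bar>z\<bar>"] p by auto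
  qed (simp add: add_increasing2)
  then show "AE x in M. norm (f x) \<le> norm (1 + \<bar>f x\<bar> powr p)" by simp
qed auto

text \<open>The domain of integration moves with the parameter, so joint measurability of its graph
  is what counts. \<open>N\<close> is left free to serve both \<open>M\<close> and
  \<open>borel\<close>.\<close>

lemma (in sigma_finite_measure) borel_measurable_set_lebesgue_integral:
  fixes f :: "'a \<Rightarrow> real"
  assumes [measurable]: "f \<in> borel_measurable M"
    and S[measurable]: "{z \<in> space (N \<Otimes>\<^sub>M M). snd z \<in> S (fst z)} \<in> sets (N \<Otimes>\<^sub>M M)"
  shows "(\<lambda>x. LINT y:S x|M. f y) \<in> borel_measurable N"
proof -
  have "(\<lambda>z. indicator {z \<in> space (N \<Otimes>\<^sub>M M). snd z \<in> S (fst z)} z * f (snd z)) \<in> borel_measurable (N \<Otimes>\<^sub>M M)"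
    by measurable
  then have "(\<lambda>(x,y). indicator (S x) y * f y) \<in> borel_measurable (N \<Otimes>\<^sub>M M)"
    by (rule measurable_cong[THEN iffD1, rotated]) (auto simp: indicator_def)
  then show ?thesis unfolding set_lebesgue_integral_def by (simp add: borel_measurable_lebesgue_integral)
qed

text \<open>The Hoelder bound at each \<open>x\<close> is integrated and the order of integration
  swapped. Integrability is claimed too, since a divergent Bochner integral is 0 and would make the
  inequality empty.\<close>

lemma (in prob_space) Hardy_uniform:
  fixes p :: real
  assumes U: "distributed M lborel U (indicator {0..1})" and p: "p > 1"
    and [measurable]: "f \<in> borel_measurable M" and f: "integrable M (\<lambda>x. \<bar>f x\<bar> powr p)"
    and S: "{z \<in> space (M \<Otimes>\<^sub>M M). snd z \<in> S (fst z)} \<in> sets (M \<Otimes>\<^sub>M M)"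
      "\<And>x. S x \<subseteq> {y\<in>space M. U y \<le> U x}"
  shows "integrable M (\<lambda>x. \<bar>(LINT y:S x|M. f y) / U x\<bar> powr p)" (is "integrable M ?T")
    and "(LINT x|M. \<bar>(LINT y:S x|M. f y) / U x\<bar> powr p) \<le> (p / (p-1)) powr p * (LINT x|M. \<bar>f x\<bar> powr p)"
proof -
  have [measurable]: "U \<in> borel_measurable M" using distributed_measurable[OF U] by simp
  interpret P: pair_sigma_finite M M ..
  have intf: "integrable M f" using p f by (intro integrable_powr_imp_integrable[of p f]) (simp_all)
  have Sx: "S x \<in> sets M" if "x \<in> space M" for x
  proof -
    have "Pair x -` {z \<in> space (M \<Otimes>\<^sub>M M). snd z \<in> S (fst z)} \<in> sets M"
      using S(1) by (rule sets_Pair1)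
    also have "Pair x -` {z \<in> space (M \<Otimes>\<^sub>M M). snd z \<in> S (fst z)} = S x"
      using S(2)[of x] that by (auto simp: space_pair_measure)
    finally show ?thesis .
  qed
  have [measurable]: "(\<lambda>x. LINT y:S x|M. f y) \<in> borel_measurable M"
    using S(1) by (intro borel_measurable_set_lebesgue_integral) auto
  define q where "q = p / (p - 1)"
  have q: "q > 1" using p by (auto simp: q_def field_simps)
  define C where "C = q powr (p - 1)"
  define g where "g = (\<lambda>y. ennreal (\<bar>f y\<bar> powr p * U y powr (1 - 1/p)))"
  have [measurable]: "g \<in> borel_measurable M" unfolding g_def by measurable
  have "(\<integral>\<^sup>+x. ennreal (?T x) \<partial>M) \<le> (\<integral>\<^sup>+x. ennreal (C * U x powr (1/p - 2)) * (\<integral>\<^sup>+y. g y * indicator {..U x} (U y) \<partial>M) \<partial>M)"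
  proof (rule nn_integral_mono_AE, use AE_uniform[OF U] AE_space in eventually_elim)
    case (elim x)
    then show ?case unfolding C_def q_def g_def
      using S(2)[of x] Sx by (intro integral_average_powr_le[OF U p _ intf]) auto
  qed
  also have "\<dots> = (\<integral>\<^sup>+x. (\<integral>\<^sup>+y. ennreal (C * U x powr (1/p - 2)) * (g y * indicator {..U x} (U y)) \<partial>M) \<partial>M)"
    by (intro nn_integral_cong nn_integral_cmult[symmetric]) auto
  also have "\<dots> = (\<integral>\<^sup>+y. (\<integral>\<^sup>+x. ennreal (C * U x powr (1/p - 2)) * (g y * indicator {..U x} (U y)) \<partial>M) \<partial>M)"
    by (intro P.Fubini') (auto simp: indicator_def)
  \<comment> \<open>For fixed \<open>y\<close> the condition \<open>U y \<le> U x\<close> restricts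
    \<open>x\<close>, so the inner integral is an upper-tail moment.\<close>
  also have "\<dots> = (\<integral>\<^sup>+y. ennreal C * g y * (\<integral>\<^sup>+x. ennreal (U x powr (1/p - 2)) * indicator {U y..} (U x) \<partial>M) \<partial>M)"
    by (subst nn_integral_cmult[symmetric])
       (auto intro!: nn_integral_cong simp: indicator_def C_def ennreal_mult mult_ac)
  \<comment> \<open>The tail moment is at most \<open>q * U y powr (-(1 - 1/p))\<close>, which
    cancels the weight in \<open>g\<close>; its factor \<open>q\<close> and
    \<open>C = q powr (p - 1)\<close> combine to \<open>q powr p\<close>.\<close>
  also have "\<dots> \<le> (\<integral>\<^sup>+y. ennreal (q powr p) * ennreal (\<bar>f y\<bar> powr p) \<partial>M)"
  proof (rule nn_integral_mono_AE, use AE_uniform[OF U] in eventually_elim)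
    case (elim y)
    have "ennreal C * g y * (\<integral>\<^sup>+x. ennreal (U x powr (1/p - 2)) * indicator {U y..} (U x) \<partial>M)
       \<le> ennreal C * g y * ennreal (- (U y powr (1/p - 2 + 1)) / (1/p - 2 + 1))"
      using p elim by (intro mult_left_mono nn_integral_uniform_atLeast_powr[OF U]) auto
    also have "- (U y powr (1/p - 2 + 1)) / (1/p - 2 + 1) = q * U y powr (-(1 - 1/p))"
    proof -
      have "1/p - 2 + 1 = - (1/q)" "1 - 1/p = 1/q"
        using p by (simp_all add: q_def field_simps)
      then show ?thesis by (simp only:) simp
    qed
    also have "ennreal C * g y * ennreal (q * U y powr (-(1 - 1/p))) = 
        ennreal (C * q * (\<bar>f y\<bar> powr p * (U y powr (1 - 1/p) * U y powr (-(1 - 1/p)))))"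
      using q by (simp add: g_def C_def ennreal_mult mult_ac)
    also have "U y powr (1 - 1/p) * U y powr (-(1 - 1/p)) = 1"
      using elim by (simp add: powr_minus del: minus_diff_eq)
    also have "C * q = q powr p" using q by (simp add: C_def powr_diff)
    finally show ?case by (simp add: ennreal_mult)
  qed
  also have "\<dots> = ennreal (q powr p * (LINT x|M. \<bar>f x\<bar> powr p))"
    using f by (simp add: nn_integral_cmult nn_integral_eq_integral ennreal_mult)
  finally have *: "(\<integral>\<^sup>+x. ennreal (?T x) \<partial>M) \<le> ennreal (q powr p * (LINT x|M. \<bar>f x\<bar> powr p))" .
  show int: "integrable M ?T"
    using * by (intro integrableI_nonneg) (auto simp: top_unique less_top[symmetric])
  show "integral\<^sup>L M ?T \<le> (p / (p-1)) powr p * (LINT x|M. \<bar>f x\<bar> powr p)"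
    using * unfolding q_def[symmetric]
    by (subst (asm) nn_integral_eq_integral[OF int]) auto
qed

section \<open>Uniform laws of \<open>F\<close> and \<open>1 - F\<close>\<close>

text \<open>The event \<open>1 - U x \<le> t\<close> has the length of \<open>{1-t..1}\<close> as
  its probability. Reflection reduces averages over right tails to those over sublevel sets.\<close>

lemma (in prob_space) uniform_reflect:
  assumes U: "distributed M lborel U (indicator {0..1})"
  shows "distributed M lborel (\<lambda>x. 1 - U x) (indicator {0..1::real})"
proof -
  have [measurable]: "U \<in> borel_measurable M" using distributed_measurable[OF U] by simp
  have "prob {x\<in>space M. 1 - U x \<le> t} = t" if t: "0 \<le> t" "t \<le> 1" for t
  proof -
    have "emeasure M {x\<in>space M. 1 - U x \<le> t} = (\<integral>\<^sup>+x. indicator {x\<in>space M. 1 - U x \<le> t} x \<partial>M)"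
      by (rule nn_integral_indicator[symmetric]) measurable
    also have "\<dots> = (\<integral>\<^sup>+x. indicator {1-t..} (U x) \<partial>M)"
      by (intro nn_integral_cong) (auto simp: indicator_def)
    also have "\<dots> = (\<integral>\<^sup>+s. indicator {0..1} s * indicator {1-t..} s \<partial>lborel)"
      by (rule distributed_nn_integral[OF U, symmetric]) auto
    also have "\<dots> = (\<integral>\<^sup>+s. indicator {1-t..1} s \<partial>lborel)"
      using t by (intro nn_integral_cong) (auto simp: indicator_def)
    also have "\<dots> = ennreal t" using t by simp
    finally show ?thesis using t by (simp add: measure_def)
  qed
  then show ?thesis
    using uniform_distrI_borel_atLeastAtMost[of "\<lambda>x. 1 - U x" 0 1] by (simp add: ennreal_indicator)
qed

text \<open>The probability integral transform. \<open>F\<close> may fail to be injective, so the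
  sublevel set of \<open>F\<close> is not inverted but squeezed between half-lines whose end points
  come from the intermediate value theorem.\<close>

lemma uniform_continuous_cdf:
  assumes F: "distribution_function F" "continuous_on UNIV F"
  shows "distributed (interval_measure F) lborel F (indicator {0..1})"
proof -
  interpret real_distribution "interval_measure F"
    using F(1) by (rule distribution_function_real_distribution)
  have cdf: "prob {..x} = F x" for x
    using distribution_function_real_distribution(2)[OF F(1)] by (metis cdf_def2)
  have [measurable]: "F \<in> borel_measurable borel"
    using F(2) by (rule borel_measurable_continuous_onI)
  have surj: "\<exists>x. F x = t" if "0 < t" "t < 1" for t
  proof -
    from F(1) have "eventually (\<lambda>x. F x < t) at_bot" "eventually (\<lambda>x. F x > t) at_top"
      using that unfolding distribution_function_def by (auto intro: order_tendstoD)
    then obtain l u where "\<And>x. x \<le> l \<Longrightarrow> F x < t" "\<And>x. x \<ge> u \<Longrightarrow> F x > t"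
      unfolding eventually_at_bot_linorder eventually_at_top_linorder by auto
    then show ?thesis using IVT'[of F "min l u" t u] F(2)
      by (meson continuous_on_subset less_imp_le min.cobounded1 min.cobounded2 order_refl subset_UNIV)
  qed
  have mono: "F x \<le> F y" if "x \<le> y" for x y
    using F(1) that by (auto simp: distribution_function_def mono_def)
  \<comment> \<open>The levels 0 and 1 need separate care because \<open>F\<close> may not attain
    them.\<close>
  have "prob {x. F x \<le> t} = t" if t: "0 \<le> t" "t \<le> 1" for t
  proof (cases "t = 1")
    case True
    have "F x \<le> 1" for x by (simp flip: cdf)
    then show ?thesis using True prob_space by simp
  next
    case False
    \<comment> \<open>\<open>F\<close> may stay at height \<open>t\<close> to the right of a point
      where it takes that value; a point at height \<open>s > t\<close> bounds the whole sublevel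
      set, and then \<open>s\<close> decreases to \<open>t\<close>.\<close>
    have "prob {x. F x \<le> t} \<le> s" if s: "t < s" "s < 1" for s
    proof -
      obtain x where x: "F x = s" using surj[of s] s t by auto
      have "y \<le> x" if "F y \<le> t" for y
        using mono[of x y] x s that by linarith
      then have "{y. F y \<le> t} \<subseteq> {..x}" by auto
      then show ?thesis using finite_measure_mono[of _ "{..x}"] cdf x by auto
    qed
    then have "prob {x. F x \<le> t} \<le> t" using t False by (intro dense_ge_bounded[of t 1]) auto
    moreover have "t \<le> prob {x. F x \<le> t}"
    proof (cases "t = 0")
      case F0: False
      obtain x where x: "F x = t" using surj[of t] F0 False t by auto
      have "{..x} \<subseteq> {y. F y \<le> t}" using mono x by auto
      then show ?thesis using finite_measure_mono[of "{..x}" "{y. F y \<le> t}"] cdf x by auto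
    qed simp
    ultimately show ?thesis by simp
  qed
  then show ?thesis
    using uniform_distrI_borel_atLeastAtMost[of F 0 1] by (simp add: ennreal_indicator)
qed

section \<open>One-sided inequalities for \<open>F\<close>, and \<open>T_k\<close> up to null
  sets\<close>

lemma Lp_norm_powr:
  assumes "p \<noteq> 0"
  shows "Lp_norm F p f powr p = (LINT x|interval_measure F. \<bar>f x\<bar> powr p)"
  using assms by (simp add: Lp_norm_def powr_powr integral_nonneg_AE)

context
  fixes F :: "real \<Rightarrow> real"
  assumes F: "distribution_function F" "continuous_on UNIV F"
begin

interpretation real_distribution "interval_measure F"
  using F(1) by (rule distribution_function_real_distribution)

text \<open>Continuity of \<open>F\<close> excludes atoms. An extended real \<open>c\<close> covers
  \<open>k\<close> and both ends of the support, finite or not.\<close>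

lemma AE_neq_ereal: "AE x in interval_measure F. ereal x \<noteq> c"
proof (cases c)
  case (real r)
  have "isCont F r" using F(2) by (simp add: continuous_on_eq_continuous_at)
  then have "prob {r} = 0"
    using isCont_cdf[of r] distribution_function_real_distribution(2)[OF F(1)] by simp
  then show ?thesis using real
    by (intro AE_I[of _ _ "{r}"]) (auto simp: emeasure_eq_measure)
qed auto

text \<open>Almost surely \<open>0 < F x < 1\<close>, which gives the weak inequalities; the absence
  of atoms makes them strict.\<close>

lemma AE_interior: "AE x in interval_measure F. lower_end F < ereal x \<and> ereal x < upper_end F"
  using AE_uniform[OF uniform_continuous_cdf[OF F]]
    AE_uniform[OF uniform_reflect[OF uniform_continuous_cdf[OF F]]]
    AE_neq_ereal[of "lower_end F"] AE_neq_ereal[of "upper_end F"]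
proof eventually_elim
  case (elim x)
  then have "lower_end F \<le> ereal x" "ereal x \<le> upper_end F"
    unfolding lower_end_def upper_end_def by (auto intro: INF_lower SUP_upper)
  with elim show ?case by (simp add: less_le)
qed

text \<open>The case \<open>U = F\<close>, where monotonicity puts \<open>{..x}\<close> inside the
  sublevel set.\<close>

lemma Hardy_left:
  fixes p :: real
  assumes p: "p > 1" and [measurable]: "h \<in> borel_measurable borel"
    and h: "integrable (interval_measure F) (\<lambda>x. \<bar>h x\<bar> powr p)"
  defines "H \<equiv> \<lambda>x. \<bar>(LINT y:{..x}|interval_measure F. h y) / F x\<bar> powr p"
  shows "integrable (interval_measure F) H"
    and "(LINT x|interval_measure F. H x) \<le> (p / (p-1)) powr p * (LINT x|interval_measure F. \<bar>h x\<bar> powr p)"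
proof -
  have "{z \<in> space (interval_measure F \<Otimes>\<^sub>M interval_measure F). snd z \<in> {..fst z}}
      \<in> sets (interval_measure F \<Otimes>\<^sub>M interval_measure F)"
    unfolding atMost_iff greaterThan_iff by measurable
  moreover have "{..x} \<subseteq> {y \<in> space (interval_measure F). F y \<le> F x}" for x
    using F(1) by (auto simp: distribution_function_def mono_def)
  ultimately show "integrable (interval_measure F) H"
     "(LINT x|interval_measure F. H x) \<le> (p / (p-1)) powr p * (LINT x|interval_measure F. \<bar>h x\<bar> powr p)"
    unfolding H_def using Hardy_uniform[OF uniform_continuous_cdf[OF F] p _ h, of "\<lambda>x. {..x}"] by simp_all
qed

text \<open>The case \<open>U = 1 - F\<close>, where \<open>{x<..}\<close> lies in the sublevel set
  because \<open>1 - F\<close> is antitone.\<close>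

lemma Hardy_right:
  fixes p :: real
  assumes p: "p > 1" and [measurable]: "h \<in> borel_measurable borel"
    and h: "integrable (interval_measure F) (\<lambda>x. \<bar>h x\<bar> powr p)"
  defines "H \<equiv> \<lambda>x. \<bar>(LINT y:{x<..}|interval_measure F. h y) / (1 - F x)\<bar> powr p"
  shows "integrable (interval_measure F) H"
    and "(LINT x|interval_measure F. H x) \<le> (p / (p-1)) powr p * (LINT x|interval_measure F. \<bar>h x\<bar> powr p)"
proof -
  have "{z \<in> space (interval_measure F \<Otimes>\<^sub>M interval_measure F). snd z \<in> {fst z<..}}
      \<in> sets (interval_measure F \<Otimes>\<^sub>M interval_measure F)"
    unfolding atMost_iff greaterThan_iff by measurable
  moreover have "{x<..} \<subseteq> {y \<in> space (interval_measure F). 1 - F y \<le> 1 - F x}" for x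
    using F(1) by (auto simp: distribution_function_def mono_def)
  ultimately show "integrable (interval_measure F) H"
     "(LINT x|interval_measure F. H x) \<le> (p / (p-1)) powr p * (LINT x|interval_measure F. \<bar>h x\<bar> powr p)"
    unfolding H_def
    using Hardy_uniform[OF uniform_reflect[OF uniform_continuous_cdf[OF F]] p _ h, of "\<lambda>x. {x<..}"] by simp_all
qed

text \<open>Membership in \<open>Lp_space\<close> asks for Borel measurability of the function
  itself, which a description almost everywhere does not give.\<close>

lemma borel_measurable_T_op:
  assumes [measurable]: "h \<in> borel_measurable borel"
  shows "T_op F k h \<in> borel_measurable borel"
proof -
  have [measurable]: "F \<in> borel_measurable borel"
    using F(2) by (rule borel_measurable_continuous_onI)
  have hM: "h \<in> borel_measurable (interval_measure F)" by simp
  have [measurable]: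
    "(\<lambda>x. LINT y:{y. lower_end F < ereal y \<and> y \<le> x}|interval_measure F. h y) \<in> borel_measurable borel"
    "(\<lambda>x. LINT y:{y. x < y \<and> ereal y < upper_end F}|interval_measure F. h y) \<in> borel_measurable borel"
    by (rule borel_measurable_set_lebesgue_integral[OF hM]; unfold mem_Collect_eq; measurable)+
  show ?thesis unfolding T_op_def[abs_def] Let_def by measurable
qed

text \<open>Cutting the domains of integration at the ends of the support removes only null
  sets.\<close>

lemma AE_T_op:
  assumes [measurable]: "h \<in> borel_measurable borel"
  shows "AE x in interval_measure F. T_op F k h x =
    (if ereal x \<le> k then (LINT y:{..x}|interval_measure F. h y) / F x
     else (LINT y:{x<..}|interval_measure F. h y) / (1 - F x))"
  using AE_interior
proof eventually_elim
  case (elim x)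
  have "(LINT y:{y. lower_end F < ereal y \<and> y \<le> x}|interval_measure F. h y) = (LINT y:{..x}|interval_measure F. h y)"
    unfolding set_lebesgue_integral_def
  proof (rule integral_cong_AE, measurable, use AE_interior in eventually_elim)
  qed (auto simp: indicator_def)
  moreover have "(LINT y:{y. x < y \<and> ereal y < upper_end F}|interval_measure F. h y) = (LINT y:{x<..}|interval_measure F. h y)"
    unfolding set_lebesgue_integral_def
  proof (rule integral_cong_AE, measurable, use AE_interior in eventually_elim)
  qed (auto simp: indicator_def)
  ultimately show ?case using elim by (auto simp: T_op_def Let_def indicator_def not_le)
qed

end

section \<open>Gluing the two sides at \<open>k\<close>\<close>

theorem theorem3p2:
  fixes F h :: "real \<Rightarrow> real" and p :: real and k :: ereal
  defines "a \<equiv> lower_end F" and "b \<equiv> upper_end F" and "\<mu> \<equiv> interval_measure F"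
  assumes F: "distribution_function F" "continuous_on UNIV F"
    and p: "1 < p"
    and h: "h \<in> Lp_space F p"
  shows "T_op F k h \<in> Lp_space F p \<and>
         (set_integrable \<mu> {x. a < ereal x \<and> ereal x \<le> k}
           (\<lambda>x. \<bar>(LINT y:{..x}|\<mu>. h y) / F x\<bar> powr p)) \<and>
         (set_integrable \<mu> {x. ereal x < b \<and> k \<le> ereal x}
           (\<lambda>x. \<bar>(LINT y:{x<..}|\<mu>. h y) / (1 - F x)\<bar> powr p)) \<and>
         (Lp_norm F p (T_op F k h) powr p =
           (LINT x:{x. a < ereal x \<and> ereal x \<le> k}|\<mu>. \<bar>(LINT y:{..x}|\<mu>. h y) / F x\<bar> powr p) +
           (LINT x:{x. ereal x < b \<and> k \<le> ereal x}|\<mu>. \<bar>(LINT y:{x<..}|\<mu>. h y) / (1 - F x)\<bar> powr p)) \<and>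
         ((LINT x:{x. a < ereal x \<and> ereal x \<le> k}|\<mu>. \<bar>(LINT y:{..x}|\<mu>. h y) / F x\<bar> powr p) +
         (LINT x:{x. ereal x < b \<and> k \<le> ereal x}|\<mu>. \<bar>(LINT y:{x<..}|\<mu>. h y) / (1 - F x)\<bar> powr p)
           \<le> (p / (p - 1)) powr p * Lp_norm F p h powr p) \<and>
         (integrable \<mu> (\<lambda>x. \<bar>1 / F x * (LINT y:{..x}|\<mu>. h y)\<bar> powr p)) \<and>
         ((LINT x|\<mu>. \<bar>1 / F x * (LINT y:{..x}|\<mu>. h y)\<bar> powr p)
           \<le> (p / (p - 1)) powr p * (LINT x|\<mu>. \<bar>h x\<bar> powr p)) \<and>
         (integrable \<mu> (\<lambda>x. \<bar>1 / (1 - F x) * (LINT y:{x<..}|\<mu>. h y)\<bar> powr p)) \<and>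
         ((LINT x|\<mu>. \<bar>1 / (1 - F x) * (LINT y:{x<..}|\<mu>. h y)\<bar> powr p)
           \<le> (p / (p - 1)) powr p * (LINT x|\<mu>. \<bar>h x\<bar> powr p))"
proof -
  interpret real_distribution \<mu>
    unfolding \<mu>_def using F(1) by (rule distribution_function_real_distribution)
  have hb[measurable]: "h \<in> borel_measurable borel" and hp: "integrable \<mu> (\<lambda>x. \<bar>h x\<bar> powr p)"
    using h by (auto simp: Lp_space_def \<mu>_def)
  define C where "C = (p / (p - 1)) powr p"
  define L where "L = (\<lambda>g x. \<bar>(LINT y:{..x}|\<mu>. g y) / F x\<bar> powr p)"
  define R where "R = (\<lambda>g x. \<bar>(LINT y:{x<..}|\<mu>. g y) / (1 - F x)\<bar> powr p)"
  define A where "A = {x. a < ereal x \<and> ereal x \<le> k}"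
  define B where "B = {x. ereal x < b \<and> k \<le> ereal x}"
  have [measurable]: "A \<in> sets borel" "B \<in> sets borel" unfolding A_def B_def by measurable
  \<comment> \<open>Kept general in \<open>g\<close> in order to apply to \<open>h\<close> and to
    its two pieces \<open>g1\<close> and \<open>g2\<close>.\<close>
  have L: "integrable \<mu> (L g)" "(LINT x|\<mu>. L g x) \<le> C * (LINT x|\<mu>. \<bar>g x\<bar> powr p)"
    and R: "integrable \<mu> (R g)" "(LINT x|\<mu>. R g x) \<le> C * (LINT x|\<mu>. \<bar>g x\<bar> powr p)"
    if "g \<in> borel_measurable borel" "integrable \<mu> (\<lambda>x. \<bar>g x\<bar> powr p)" for g
    using Hardy_left[OF F p, of g] Hardy_right[OF F p, of g] that
    unfolding \<mu>_def C_def L_def R_def by auto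
  have LA: "set_integrable \<mu> A (L h)" and RB: "set_integrable \<mu> B (R h)"
    unfolding set_integrable_def using L(1)[of h] R(1)[of h] hp
    by (auto intro!: integrable_mult_indicator simp del: real_scaleR_def)
  \<comment> \<open>\<open>A\<close> and \<open>B\<close> overlap at most in the point
    \<open>k\<close>, where the right side counts both terms; that point is null.\<close>
  have T: "AE x in \<mu>. \<bar>T_op F k h x\<bar> powr p = indicator A x * L h x + indicator B x * R h x"
    using AE_T_op[OF F hb, of k] AE_interior[OF F] AE_neq_ereal[OF F, of k] unfolding \<mu>_def[symmetric]
  proof eventually_elim
    case (elim x)
    then show ?case
      by (auto simp: A_def B_def L_def R_def a_def b_def indicator_def)
  qed
  have T_borel[measurable]: "T_op F k h \<in> borel_measurable borel"
    by (rule borel_measurable_T_op[OF F]) measurable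
  have intLR: "integrable \<mu> (\<lambda>x. indicator A x * L h x)" "integrable \<mu> (\<lambda>x. indicator B x * R h x)"
    using LA RB by (auto simp: set_integrable_def)
  have [measurable]: "L h \<in> borel_measurable borel" "R h \<in> borel_measurable borel"
    using L(1)[of h] R(1)[of h] hp borel_measurable_integrable by auto
  have intT: "integrable \<mu> (\<lambda>x. \<bar>T_op F k h x\<bar> powr p)"
    using intLR by (subst integrable_cong_AE[OF _ _ T]) auto
  have norm_T: "(LINT x|\<mu>. \<bar>T_op F k h x\<bar> powr p) = (LINT x:A|\<mu>. L h x) + (LINT x:B|\<mu>. R h x)"
    unfolding set_lebesgue_integral_def using intLR
    by (subst integral_cong_AE[OF _ _ T]) auto
  \<comment> \<open>Applying both one-sided inequalities to \<open>h\<close> would double the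
    constant. The pieces have disjoint supports, so their \<open>p\<close>-th power integrals add up
    to that of \<open>h\<close>.\<close>
  define g1 where "g1 = (\<lambda>x. indicator {x. ereal x \<le> k} x * h x)"
  define g2 where "g2 = (\<lambda>x. indicator {x. k < ereal x} x * h x)"
  have [measurable]: "g1 \<in> borel_measurable borel" "g2 \<in> borel_measurable borel"
    unfolding g1_def g2_def by measurable
  have g: "integrable \<mu> (\<lambda>x. \<bar>g1 x\<bar> powr p)" "integrable \<mu> (\<lambda>x. \<bar>g2 x\<bar> powr p)"
    using p by (auto intro!: Bochner_Integration.integrable_bound[OF hp] simp: g1_def g2_def indicator_def)
  have "L h x = L g1 x" if "ereal x \<le> k" for x
  proof -
    have "ereal y \<le> k" if "y \<le> x" for y
      using that \<open>ereal x \<le> k\<close> by (meson ereal_less_eq(3) order_trans)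
    then have "(LINT y:{..x}|\<mu>. h y) = (LINT y:{..x}|\<mu>. g1 y)"
      by (intro set_lebesgue_integral_cong) (auto simp: g1_def)
    then show ?thesis by (simp add: L_def)
  qed
  \<comment> \<open>Off \<open>A\<close> the right side only gains the nonnegative values of
    \<open>L g1\<close>.\<close>
  then have "(LINT x:A|\<mu>. L h x) \<le> (LINT x|\<mu>. L g1 x)"
    unfolding set_lebesgue_integral_def using intLR L(1)[of g1] g
    by (intro integral_mono) (auto simp: A_def L_def indicator_def)
  also have "\<dots> \<le> C * (LINT x|\<mu>. \<bar>g1 x\<bar> powr p)" using g by (intro L) auto
  finally have 1: "(LINT x:A|\<mu>. L h x) \<le> C * (LINT x|\<mu>. \<bar>g1 x\<bar> powr p)" .
  \<comment> \<open>This includes \<open>x = k\<close>: the half-line \<open>{x<..}\<close> is open,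
    so the strict cut in \<open>g2\<close> removes nothing from it.\<close>
  have "R h x = R g2 x" if "k \<le> ereal x" for x
  proof -
    have "k < ereal y" if "x < y" for y
      using that \<open>k \<le> ereal x\<close> by (meson ereal_less(1) less_ereal.simps(1) le_less_trans)
    then have "(LINT y:{x<..}|\<mu>. h y) = (LINT y:{x<..}|\<mu>. g2 y)"
      by (intro set_lebesgue_integral_cong) (auto simp: g2_def)
    then show ?thesis by (simp add: R_def)
  qed
  then have "(LINT x:B|\<mu>. R h x) \<le> (LINT x|\<mu>. R g2 x)"
    unfolding set_lebesgue_integral_def using intLR R(1)[of g2] g
    by (intro integral_mono) (auto simp: B_def R_def indicator_def)
  also have "\<dots> \<le> C * (LINT x|\<mu>. \<bar>g2 x\<bar> powr p)" using g by (intro R) auto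
  finally have 2: "(LINT x:B|\<mu>. R h x) \<le> C * (LINT x|\<mu>. \<bar>g2 x\<bar> powr p)" .
  have "(LINT x|\<mu>. \<bar>g1 x\<bar> powr p) + (LINT x|\<mu>. \<bar>g2 x\<bar> powr p) = (LINT x|\<mu>. \<bar>g1 x\<bar> powr p + \<bar>g2 x\<bar> powr p)"
    using g by simp
  also have "\<dots> = (LINT x|\<mu>. \<bar>h x\<bar> powr p)"
    using p by (intro Bochner_Integration.integral_cong) (auto simp: g1_def g2_def indicator_def not_le)
  finally have "(LINT x:A|\<mu>. L h x) + (LINT x:B|\<mu>. R h x) \<le> C * (LINT x|\<mu>. \<bar>h x\<bar> powr p)"
    using 1 2 by (metis add_mono distrib_left)
  moreover have "T_op F k h \<in> Lp_space F p"
    using T_borel intT by (simp add: Lp_space_def \<mu>_def)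
  moreover have "Lp_norm F p f powr p = (LINT x|\<mu>. \<bar>f x\<bar> powr p)" for f
    using p by (simp add: Lp_norm_powr \<mu>_def)
  \<comment> \<open>The two one-sided inequalities are \<open>L\<close> and \<open>R\<close> for
    \<open>h\<close> itself, with no passage through infinite \<open>k\<close>.\<close>
  ultimately show ?thesis
    using LA RB norm_T L[of h] R[of h] hp
    unfolding A_def B_def L_def R_def C_def by simp
qed

end
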